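(* Let $G$ be a group generated as a monoid by a subset $A\subseteq G$ closed under $G$-conjugation, let $c\in G$ with $A_c$ finite and $\ell_A(c)\ge 3$. Assume there exists $a\in A_c$ such that, apart possibly from $a^2$, exactly one element $g_a$ of $\mathcal{P}_c$ covers $a$. Assume moreover that $\mathcal{P}_c$ is totally chain-connected. If $abb\le_A c$ for some $b\in A_c\setminus\{a\}$, and $|A_{g_a}|\ge 4$, then there does not exist a $c$-compatible order of $A_c$.
   Context: For $x\in G$, $\ell_A(x)$ is the least $k\ge 0$ such that $x$ is a product of $k$ elements of $A$; a reduced $A$-factorization is such a product with $k=\ell_A(x)$, written as a tuple. $x\le_A y$ iff $\ell_A(x)+\ell_A(x^{-1}y)=\ell_A(y)$; $\mathcal{P}_g=[e,g]_A$ ordered by $\le_A$ and $A_g=\{b\in A: b\le_A g\}$. The chain graph of a bounded graded poset has maximal chains as vertices, adjacent when they differ in exactly one element; the poset is chain-connected if this graph is connected and totally chain-connected if every interval is chain-connected. A linear order $\prec$ on $A_c$ is $c$-compatible if every $h\le_A c$ with $\ell_A(h)=2$ has exactly one reduced $A$-factorization $(x,y)$ with $x\preceq y$.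
   Formalization: It is additionally assumed that the identity e is not in A; if e is in A, then e is counted in |A_{g_a}| and the claim fails (e.g. SL(2,3), A = {e} with a class of order-3 elements, c = abb). *)

theory Defs
  imports "HOL-Algebra.Group"
begin

section \<open>Posets given by a carrier set and a relation\<close>

definition covers_in :: "'a set \<Rightarrow> ('a \<Rightarrow> 'a \<Rightarrow> bool) \<Rightarrow> 'a \<Rightarrow> 'a \<Rightarrow> bool" where
  "covers_in P R y x \<longleftrightarrow>
     x \<in> P \<and> y \<in> P \<and> R x y \<and> x \<noteq> y \<and>
     (\<forall>z\<in>P. R x z \<longrightarrow> R z y \<longrightarrow> z = x \<or> z = y)"

text \<open>
  Edges of the chain graph. In a graded poset all maximal chains have the same length, so
  differing in exactly one element means that one element is exchanged for another.
\<close>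
definition chain_adjacent :: "'a set \<Rightarrow> ('a \<Rightarrow> 'a \<Rightarrow> bool) \<Rightarrow> 'a set \<Rightarrow> 'a set \<Rightarrow> bool" where
  "chain_adjacent P R C D \<longleftrightarrow>
     pred_on.maxchain P R C \<and> pred_on.maxchain P R D \<and>
     card (C - D) = 1 \<and> card (D - C) = 1"

definition chain_connected :: "'a set \<Rightarrow> ('a \<Rightarrow> 'a \<Rightarrow> bool) \<Rightarrow> bool" where
  "chain_connected P R \<longleftrightarrow>
     (\<forall>C D. pred_on.maxchain P R C \<longrightarrow> pred_on.maxchain P R D \<longrightarrow>
        (chain_adjacent P R)\<^sup>*\<^sup>* C D)"

definition totally_chain_connected :: "'a set \<Rightarrow> ('a \<Rightarrow> 'a \<Rightarrow> bool) \<Rightarrow> bool" where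
  "totally_chain_connected P R \<longleftrightarrow>
     (\<forall>x\<in>P. \<forall>y\<in>P. R x y \<longrightarrow> chain_connected {z \<in> P. R x z \<and> R z y} R)"


section \<open>Factorization posets\<close>

definition list_mult :: "('a, 'b) monoid_scheme \<Rightarrow> 'a list \<Rightarrow> 'a" where
  "list_mult G xs = foldr (mult G) xs (one G)"

definition conj_closed_monoid_generators :: "('a, 'b) monoid_scheme \<Rightarrow> 'a set \<Rightarrow> bool" where
  "conj_closed_monoid_generators G A \<longleftrightarrow>
     A \<subseteq> carrier G \<and>
     (\<forall>g\<in>carrier G. \<exists>xs. set xs \<subseteq> A \<and> list_mult G xs = g) \<and>
     (\<forall>g\<in>carrier G. \<forall>a\<in>A. g \<otimes>\<^bsub>G\<^esub> a \<otimes>\<^bsub>G\<^esub> inv\<^bsub>G\<^esub> g \<in> A)"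

definition gen_length :: "('a, 'b) monoid_scheme \<Rightarrow> 'a set \<Rightarrow> 'a \<Rightarrow> nat" where
  "gen_length G A x =
     (LEAST k. \<exists>xs. set xs \<subseteq> A \<and> length xs = k \<and> list_mult G xs = x)"

definition reduced_factorization :: "('a, 'b) monoid_scheme \<Rightarrow> 'a set \<Rightarrow> 'a \<Rightarrow> 'a list \<Rightarrow> bool" where
  "reduced_factorization G A x xs \<longleftrightarrow>
     set xs \<subseteq> A \<and> list_mult G xs = x \<and> length xs = gen_length G A x"

definition gen_le :: "('a, 'b) monoid_scheme \<Rightarrow> 'a set \<Rightarrow> 'a \<Rightarrow> 'a \<Rightarrow> bool" where
  "gen_le G A x y \<longleftrightarrow>
     x \<in> carrier G \<and> y \<in> carrier G \<and>
     gen_length G A x + gen_length G A (inv\<^bsub>G\<^esub> x \<otimes>\<^bsub>G\<^esub> y) = gen_length G A y"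

definition fact_poset :: "('a, 'b) monoid_scheme \<Rightarrow> 'a set \<Rightarrow> 'a \<Rightarrow> 'a set" where
  "fact_poset G A g = {x. gen_le G A \<one>\<^bsub>G\<^esub> x \<and> gen_le G A x g}"

text \<open>
  When \<open>\<one>\<close> is not a generator, these are exactly the atoms of \<open>fact_poset G A g\<close>. If it were,
  it would belong to every \<open>gens_below G A g\<close> without occurring in any reduced factorization,
  and cardinality conditions on this set would be off by one.
\<close>
definition gens_below :: "('a, 'b) monoid_scheme \<Rightarrow> 'a set \<Rightarrow> 'a \<Rightarrow> 'a set" where
  "gens_below G A g = {b \<in> A. gen_le G A b g}"

text \<open>The order is the reflexive one: \<open>(x, y) \<in> r\<close> stands for \<open>x \<preceq> y\<close>.\<close>
definition compatible_order :: "('a, 'b) monoid_scheme \<Rightarrow> 'a set \<Rightarrow> 'a \<Rightarrow> 'a rel \<Rightarrow> bool" where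
  "compatible_order G A c r \<longleftrightarrow>
     linear_order_on (gens_below G A c) r \<and>
     (\<forall>h. gen_le G A h c \<longrightarrow> gen_length G A h = 2 \<longrightarrow>
        (\<exists>!p. reduced_factorization G A h [fst p, snd p] \<and> p \<in> r))"

end

theory Submission
  imports Defs
begin

text \<open>
  A compatible order singles out one ascent among the factorizations of each \<open>g \<le> c\<close> of length 2.
  Since a Hurwitz orbit of such factorizations is a cycle and cannot descend forever, it contains
  the ascent; so the factorizations form a single cycle of length \<open>card A\<^sub>g\<close>.

  Because \<open>a\<close> has a single cover \<open>g = a b\<close> besides \<open>a\<^sup>2\<close>, either \<open>a\<close> and \<open>b\<close> commute, and then
  the cycle has length 2, or \<open>h = a b b \<le> c\<close> has length 3 for this \<open>b\<close>. In the second case,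
  the cycle of \<open>g\<close> and its conjugates by powers of \<open>h\<close> are linked: two consecutive generators of one
  cycle reappear, in reversed order, in the next. If \<open>card A\<^sub>g \<ge> 4\<close>, uniqueness of
  the ascent in each cycle makes the conjugates of \<open>b\<close> by powers of \<open>h\<close> eventually strictly
  decreasing, which is impossible as \<open>A\<^sub>c\<close> is finite.
\<close>

section \<open>Finite linear orders\<close>

text \<open>A linear order on a finite set is a well-order, so its strict part is
  well-founded.\<close>

lemma linear_order_no_infinite_descent:
  assumes "linear_order_on S r" "finite S"
    and "\<And>n::nat. (f (Suc n), f n) \<in> r" "\<And>n. f (Suc n) \<noteq> f n"
  shows False
proof -
  have "r \<subseteq> S \<times> S"
    using assms(1) by (simp add: order_on_defs)
  then have "finite r"
    using assms(2) by (meson finite_SigmaI finite_subset)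
  then have "wf (r - Id)"
    using assms(1) by (metis linear_order_on_well_order_on well_order_on_def)
  then show False
    using assms(3,4) by (auto simp: wf_iff_no_infinite_down_chain)
qed

text \<open>No orbit can descend forever, so every orbit in \<open>S\<close> meets the unique
  ascent. Injectivity makes the cycle of \<open>y\<close> closed under preimages as well as images;
  it contains the ascent, hence every point whose orbit reaches the ascent, which is all of
  \<open>S\<close>.\<close>

lemma card_le_period_of_unique_ascent:
  assumes lin: "linear_order_on S r" and fin: "finite S"
    and inj: "inj F" and maps: "\<And>x. x \<in> S \<Longrightarrow> F x \<in> S"
    and unique: "\<exists>!x. x \<in> S \<and> (x, F x) \<in> r"
    and y: "y \<in> S" "(F ^^ d) y = y" "d > 0"
  shows "card S \<le> d"
proof -
  obtain x where x: "\<And>z. z \<in> S \<Longrightarrow> (z, F z) \<in> r \<Longrightarrow> z = x"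
    using unique by blast
  have iter: "(F ^^ i) z \<in> S" if "z \<in> S" for i z
    using that maps by (induction i) auto
  have reach: "\<exists>i. (F ^^ i) z = x" if z: "z \<in> S" for z
  proof (rule ccontr)
    assume no: "\<nexists>i. (F ^^ i) z = x"
    have desc: "((F ^^ i) z, (F ^^ Suc i) z) \<notin> r" for i
      using no x[OF iter[OF z, of i]] by auto
    \<comment> \<open>A fixed point would itself be an ascent, as \<open>r\<close> is reflexive on
      \<open>S\<close>.\<close>
    have ne: "(F ^^ Suc i) z \<noteq> (F ^^ i) z" for i
    proof
      assume "(F ^^ Suc i) z = (F ^^ i) z"
      then show False
        using desc[of i] lin iter[OF z, of i] by (simp add: order_on_defs refl_on_def)
    qed
    have "((F ^^ Suc i) z, (F ^^ i) z) \<in> r" for i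
      using desc[of i] ne[of i] lin iter[OF z, of i] iter[OF z, of "Suc i"]
      by (metis linear_order_on_def total_on_def)
    then show False
      using linear_order_no_infinite_descent[OF lin fin, of "\<lambda>i. (F ^^ i) z"] ne by blast
  qed
  \<comment> \<open>The period \<open>d\<close> may be a proper multiple of the least one, so only
    an upper bound on \<open>card T\<close> is available.\<close>
  define T where "T = (\<lambda>i. (F ^^ i) y) ` {..<d}"
  have finT: "finite T" and cardT: "card T \<le> d"
    unfolding T_def using card_image_le[of "{..<d}"] by auto
  have "F z \<in> T" if "z \<in> T" for z
  proof -
    obtain i where i: "i < d" "z = (F ^^ i) y"
      using \<open>z \<in> T\<close> unfolding T_def by auto
    have "F z = (F ^^ Suc i) y"
      using i by simp
    moreover have "(F ^^ Suc i) y \<in> T"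
    proof (cases "Suc i = d")
      case True
      then have "(F ^^ Suc i) y = (F ^^ 0) y"
        using y(2) by simp
      then show ?thesis
        unfolding T_def using y(3) by blast
    qed (use i in \<open>auto simp: T_def simp del: funpow.simps\<close>)
    ultimately show ?thesis by simp
  qed
  then have "F ` T \<subseteq> T" by auto
  then have FT: "F ` T = T"
    using finT inj by (meson endo_inj_surj inj_on_subset subset_UNIV)
  have pull: "z \<in> T" if "F z \<in> T" for z
    using that FT inj by (metis image_iff injD)
  have pull_iter: "(F ^^ i) z \<in> T \<Longrightarrow> z \<in> T" for i z
    by (induction i) (auto dest: pull)
  have push_iter: "(F ^^ i) z \<in> T" if "z \<in> T" for i z
    using that FT by (induction i) auto
  have "y \<in> T"
    unfolding T_def using y(3) by (metis funpow_0 imageI lessThan_iff)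
  then have "x \<in> T"
    using reach[OF y(1)] push_iter by metis
  then have "z \<in> T" if "z \<in> S" for z
    using reach[OF that] pull_iter by auto
  then have "S \<subseteq> T" by blast
  then show ?thesis
    using card_mono[OF finT, of S] cardT by linarith
qed

text \<open>
  If step \<open>m\<close> ascends from \<open>s3 m\<close> to \<open>s4 m\<close> then its two middle steps descend. If it does not,
  the reversed pair is the ascent of step \<open>m + 1\<close>, whose other steps then all descend, and this
  propagates. So from some point on \<open>s3 (m + 1) \<prec> s1 (m + 1) = s3 m\<close>.
\<close>
lemma no_linked_unique_ascents:
  fixes s0 s1 s2 s3 s4 :: "nat \<Rightarrow> 'a"
  assumes lin: "linear_order_on S r" and fin: "finite S"
    and mem: "\<And>m. {s0 m, s1 m, s2 m, s3 m, s4 m} \<subseteq> S"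
    and link: "\<And>m. s0 (Suc m) = s4 m" "\<And>m. s1 (Suc m) = s3 m"
    and first: "\<And>m. (s0 m, s1 m) \<in> r \<Longrightarrow>
      (s1 m, s2 m) \<notin> r \<and> (s2 m, s3 m) \<notin> r \<and> (s3 m, s4 m) \<notin> r"
    and last: "\<And>m. (s3 m, s4 m) \<in> r \<Longrightarrow> (s1 m, s2 m) \<notin> r \<and> (s2 m, s3 m) \<notin> r"
    and ne: "\<And>m. s1 m \<noteq> s3 m"
  shows False
proof -
  have refl: "(x, x) \<in> r" if "x \<in> S" for x
    using lin that by (simp add: order_on_defs refl_on_def)
  have total: "(y, x) \<in> r" if "(x, y) \<notin> r" "x \<in> S" "y \<in> S" for x y
    using lin that refl by (metis linear_order_on_def total_on_def)
  have trans: "trans r"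
    using lin by (simp add: order_on_defs)
  have down: "(s3 m, s1 m) \<in> r" if "(s1 m, s2 m) \<notin> r" "(s2 m, s3 m) \<notin> r" for m
    using total[OF that(1)] total[OF that(2)] mem[of m] transD[OF trans] by auto
  have "\<exists>k. \<forall>m\<ge>k. (s1 m, s2 m) \<notin> r \<and> (s2 m, s3 m) \<notin> r"
  proof (cases "\<forall>m. (s3 m, s4 m) \<in> r")
    case True
    then show ?thesis using last by blast
  next
    case False
    then obtain k where k: "(s3 k, s4 k) \<notin> r" by blast
    have flip: "(s0 (Suc m), s1 (Suc m)) \<in> r" if "(s3 m, s4 m) \<notin> r" for m
      using total[OF that] mem[of m] link by simp
    have stay: "(s3 m, s4 m) \<notin> r" if "m \<ge> k" for m
      using that by (induction m rule: dec_induct) (use k flip first in blast)+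
    have "(s1 m, s2 m) \<notin> r \<and> (s2 m, s3 m) \<notin> r" if m: "m \<ge> Suc k" for m
    proof -
      obtain n where "m = Suc n" "n \<ge> k"
        using m Suc_le_D by blast
      then show ?thesis
        using first flip stay by blast
    qed
    then show ?thesis by blast
  qed
  then obtain k where k: "\<And>m. m \<ge> k \<Longrightarrow> (s3 m, s1 m) \<in> r"
    using down by blast
  have "(s3 (k + Suc i), s3 (k + i)) \<in> r" for i
    using k[of "k + Suc i"] link(2)[of "k + i"] by simp
  moreover have "s3 (k + Suc i) \<noteq> s3 (k + i)" for i
    using ne[of "k + Suc i"] link(2)[of "k + i"] by simp
  ultimately show False
    using linear_order_no_infinite_descent[OF lin fin, of "\<lambda>i. s3 (k + i)"] by blast
qed


section \<open>Length functions of generated groups\<close>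

text \<open>Excluding \<open>\<one>\<close> makes the generators exactly the elements of length
  1.\<close>

locale conj_generated_group = group G for G (structure) +
  fixes A :: "'a set"
  assumes gens: "conj_closed_monoid_generators G A"
    and one_notin: "\<one> \<notin> A"
begin

abbreviation len :: "'a \<Rightarrow> nat" where "len \<equiv> gen_length G A"

abbreviation le :: "'a \<Rightarrow> 'a \<Rightarrow> bool" where "le \<equiv> gen_le G A"

abbreviation conj_by :: "'a \<Rightarrow> 'a \<Rightarrow> 'a" where "conj_by k x \<equiv> inv k \<otimes> x \<otimes> k"

lemma A_closed [simp, intro]: "x \<in> A \<Longrightarrow> x \<in> carrier G"
  using gens by (auto simp: conj_closed_monoid_generators_def)

lemma inv_cancel_left [simp]:
  assumes "x \<in> carrier G" "y \<in> carrier G"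
  shows "inv x \<otimes> (x \<otimes> y) = y" "x \<otimes> (inv x \<otimes> y) = y"
  using assms by (simp_all flip: m_assoc)

section \<open>Conjugation and products of words in \<open>A\<close>\<close>

lemma conj_mem:
  assumes "x \<in> A" "k \<in> carrier G"
  shows "k \<otimes> x \<otimes> inv k \<in> A" "conj_by k x \<in> A"
proof -
  show "k \<otimes> x \<otimes> inv k \<in> A"
    using gens assms by (auto simp: conj_closed_monoid_generators_def)
  have "inv k \<otimes> x \<otimes> inv (inv k) \<in> A"
    using gens assms inv_closed unfolding conj_closed_monoid_generators_def by blast
  then show "conj_by k x \<in> A" using assms by simp
qed

lemma list_mult_closed: "set xs \<subseteq> A \<Longrightarrow> list_mult G xs \<in> carrier G"
  by (induction xs) (auto simp: list_mult_def)

lemma list_mult_append: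
  "set xs \<subseteq> A \<Longrightarrow> set ys \<subseteq> A \<Longrightarrow> list_mult G (xs @ ys) = list_mult G xs \<otimes> list_mult G ys"
  using list_mult_closed
  by (induction xs) (auto simp: list_mult_def m_assoc)

lemma list_mult_map_conj:
  "set xs \<subseteq> A \<Longrightarrow> k \<in> carrier G \<Longrightarrow>
    list_mult G (map (conj_by k) xs) = conj_by k (list_mult G xs)"
proof (induction xs)
  case (Cons x xs)
  then have "list_mult G xs \<in> carrier G" "x \<in> carrier G"
    using list_mult_closed by auto
  with Cons show ?case by (simp add: list_mult_def m_assoc)
qed (simp add: list_mult_def)

section \<open>Word length\<close>

lemma len_list_le: "set xs \<subseteq> A \<Longrightarrow> len (list_mult G xs) \<le> length xs"
  unfolding gen_length_def by (rule Least_le) blast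

lemma exists_reduced:
  assumes "x \<in> carrier G"
  shows "\<exists>xs. reduced_factorization G A x xs"
proof -
  have "\<exists>k xs. set xs \<subseteq> A \<and> length xs = k \<and> list_mult G xs = x"
    using gens assms by (auto simp: conj_closed_monoid_generators_def)
  from LeastI_ex[OF this] show ?thesis
    by (auto simp: gen_length_def reduced_factorization_def)
qed

lemma len_mult_le:
  assumes "x \<in> carrier G" "y \<in> carrier G"
  shows "len (x \<otimes> y) \<le> len x + len y"
proof -
  obtain xs ys where "reduced_factorization G A x xs" "reduced_factorization G A y ys"
    using exists_reduced assms by blast
  then show ?thesis
    using len_list_le[of "xs @ ys"] list_mult_append[of xs ys]
    by (auto simp: reduced_factorization_def)
qed

text \<open>Conjugating a reduced word letter by letter gives one inequality; conjugating back gives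
  the other.\<close>

lemma len_conj:
  assumes "x \<in> carrier G" "k \<in> carrier G"
  shows "len (conj_by k x) = len x"
proof -
  have le: "len (conj_by k x) \<le> len x" if xk: "x \<in> carrier G" "k \<in> carrier G" for k x
  proof -
    obtain xs where xs: "reduced_factorization G A x xs"
      using exists_reduced[OF xk(1)] by blast
    then have "set (map (conj_by k) xs) \<subseteq> A"
      using conj_mem xk(2) by (auto simp: reduced_factorization_def)
    then show ?thesis
      using len_list_le list_mult_map_conj[of xs k] xk(2) xs
      unfolding reduced_factorization_def by (metis length_map)
  qed
  have "conj_by (inv k) (conj_by k x) = x"
    using assms by (simp add: m_assoc)
  then show ?thesis
    using le[OF assms] le[of "conj_by k x" "inv k"] assms by simp
qed

lemma len_one [simp]: "len \<one> = 0"
  using len_list_le[of "[]"] by (simp add: list_mult_def)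

lemma len_eq_0: "x \<in> carrier G \<Longrightarrow> len x = 0 \<longleftrightarrow> x = \<one>"
  using exists_reduced[of x] by (auto simp: reduced_factorization_def list_mult_def)

lemma len_eq_1: "x \<in> carrier G \<Longrightarrow> len x = 1 \<longleftrightarrow> x \<in> A"
proof
  assume "x \<in> carrier G" "len x = 1"
  then obtain xs where "set xs \<subseteq> A" "list_mult G xs = x" "length xs = 1"
    using exists_reduced unfolding reduced_factorization_def by metis
  then show "x \<in> A"
    by (auto simp: length_Suc_conv list_mult_def)
next
  assume "x \<in> A"
  then have "len x \<le> 1" "len x \<noteq> 0"
    using len_list_le[of "[x]"] len_eq_0[of x] one_notin by (auto simp: list_mult_def)
  then show "len x = 1" by simp
qed

lemma len_gen [simp]: "x \<in> A \<Longrightarrow> len x = 1"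
  using len_eq_1 by blast

lemma exists_first_letter:
  assumes "x \<in> carrier G" "len x \<ge> 1"
  obtains y z where "y \<in> A" "z \<in> carrier G" "x = y \<otimes> z" "len x = Suc (len z)"
proof -
  obtain xs where xs: "set xs \<subseteq> A" "list_mult G xs = x" "length xs = len x"
    using exists_reduced[OF assms(1)] by (auto simp: reduced_factorization_def)
  then obtain y ys where ys: "xs = y # ys"
    using assms(2) by (cases xs) auto
  define z where "z = list_mult G ys"
  have *: "y \<in> A" "z \<in> carrier G" "x = y \<otimes> z"
    using xs ys list_mult_closed[of ys] by (auto simp: z_def list_mult_def)
  have "len z \<le> length ys"
    using len_list_le[of ys] xs ys by (auto simp: z_def)
  moreover have "len x \<le> 1 + len z"
    using len_mult_le[of y z] len_eq_1[of y] * by auto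
  ultimately show ?thesis
    using that[OF *] xs ys by auto
qed

section \<open>The prefix order\<close>

lemma le_iff_prod:
  assumes "x \<in> carrier G" "z \<in> carrier G"
  shows "le x (x \<otimes> z) \<longleftrightarrow> len (x \<otimes> z) = len x + len z"
  using assms by (auto simp: gen_le_def)

lemma le_one_left: "x \<in> carrier G \<Longrightarrow> le \<one> x"
  by (simp add: gen_le_def)

lemma le_trans:
  assumes "le x y" "le y z"
  shows "le x z"
proof -
  have c: "x \<in> carrier G" "y \<in> carrier G" "z \<in> carrier G"
    using assms by (auto simp: gen_le_def)
  have "len (inv x \<otimes> z) \<le> len (inv x \<otimes> y) + len (inv y \<otimes> z)"
    using len_mult_le[of "inv x \<otimes> y" "inv y \<otimes> z"] c by (simp add: m_assoc)
  moreover have "len z \<le> len x + len (inv x \<otimes> z)"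
    using len_mult_le[of x "inv x \<otimes> z"] c by simp
  ultimately show ?thesis
    using assms c by (auto simp: gen_le_def)
qed

lemma le_conj:
  assumes "le x y" "k \<in> carrier G"
  shows "le (conj_by k x) (conj_by k y)"
proof -
  have c: "x \<in> carrier G" "y \<in> carrier G"
    using assms by (auto simp: gen_le_def)
  have "inv (conj_by k x) \<otimes> conj_by k y = conj_by k (inv x \<otimes> y)"
    using c assms(2) by (simp add: m_assoc inv_mult_group)
  then show ?thesis
    using assms c by (simp add: gen_le_def len_conj)
qed

section \<open>Elements of length 2 and 3, and covers of a generator\<close>

lemma reduced_pair_iff:
  "len g = 2 \<Longrightarrow> reduced_factorization G A g [x, y] \<longleftrightarrow> x \<in> A \<and> y \<in> A \<and> x \<otimes> y = g"
  by (auto simp: reduced_factorization_def list_mult_def)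

lemma gens_below_len_2:
  assumes "g \<in> carrier G" "len g = 2"
  shows "gens_below G A g = {x \<in> A. inv x \<otimes> g \<in> A}"
proof -
  have "le x g \<longleftrightarrow> inv x \<otimes> g \<in> A" if "x \<in> A" for x
    using assms that len_eq_1[of "inv x \<otimes> g"] by (auto simp: gen_le_def)
  then show ?thesis by (auto simp: gens_below_def)
qed

text \<open>Each letter adds at most 1 to the length, so a product of three letters with length 3
  leaves no slack in its prefixes.\<close>

lemma prefix_of_length_3:
  assumes "x \<in> A" "y \<in> A" "z \<in> A" "len (x \<otimes> y \<otimes> z) = 3"
  shows "len (x \<otimes> y) = 2" "le (x \<otimes> y) (x \<otimes> y \<otimes> z)"
proof -
  have "len (x \<otimes> y) \<le> 2"
    using len_mult_le[of x y] assms by simp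
  moreover have "3 \<le> len (x \<otimes> y) + 1"
    using len_mult_le[of "x \<otimes> y" z] len_eq_1[of z] assms by auto
  ultimately show "len (x \<otimes> y) = 2" by simp
  then show "le (x \<otimes> y) (x \<otimes> y \<otimes> z)"
    using le_iff_prod[of "x \<otimes> y" z] assms len_eq_1[of z] by auto
qed

text \<open>If \<open>x\<close> is the first letter of a reduced word for
  \<open>inv a \<otimes> g\<close>, then \<open>a \<otimes> x\<close> lies between \<open>a\<close>
  and \<open>g\<close>, so a cover has length 2. Conversely, additivity of lengths leaves no room
  between lengths 1 and 2.\<close>

lemma covers_of_gen:
  assumes "a \<in> A" "c \<in> carrier G"
  shows "covers_in (fact_poset G A c) le g a \<longleftrightarrow>
    (\<exists>x\<in>A. g = a \<otimes> x \<and> len g = 2 \<and> le g c)"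
proof
  assume cov: "covers_in (fact_poset G A c) le g a"
  then have ag: "le a g" "a \<noteq> g" "le g c" and
    between: "\<And>z. le a z \<Longrightarrow> le z g \<Longrightarrow> le z c \<Longrightarrow> z = a \<or> z = g"
    by (auto simp: covers_in_def fact_poset_def gen_le_def)
  have g: "g \<in> carrier G" using ag by (simp add: gen_le_def)
  have len_g: "len g = 1 + len (inv a \<otimes> g)"
    using ag assms by (auto simp: gen_le_def)
  have "len (inv a \<otimes> g) \<noteq> 0"
    using len_eq_0[of "inv a \<otimes> g"] ag(2) assms g inv_solve_left'[of \<one> a g] by auto
  then obtain x v where xv: "x \<in> A" "v \<in> carrier G" "inv a \<otimes> g = x \<otimes> v"
      "len (inv a \<otimes> g) = Suc (len v)"
    using exists_first_letter[of "inv a \<otimes> g"] assms g by auto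
  have g_eq: "g = a \<otimes> x \<otimes> v"
    using xv assms g inv_cancel_left(2)[of a g] by (simp add: m_assoc)
  have "len (a \<otimes> x) \<le> 2"
    using len_mult_le[of a x] assms xv by simp
  moreover have "len g \<le> len (a \<otimes> x) + len v"
    using g_eq len_mult_le xv assms by auto
  ultimately have two: "len (a \<otimes> x) = 2"
    using len_g xv by simp
  have "le (a \<otimes> x) g"
    using le_iff_prod[of "a \<otimes> x" v] two g_eq len_g xv assms by auto
  moreover have "le a (a \<otimes> x)"
    using le_iff_prod[of a x] two assms xv by auto
  moreover have "a \<otimes> x \<noteq> a"
    using two assms by auto
  ultimately have "g = a \<otimes> x"
    using between ag le_trans by metis
  then show "\<exists>x\<in>A. g = a \<otimes> x \<and> len g = 2 \<and> le g c"
    using two ag xv by blast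
next
  assume "\<exists>x\<in>A. g = a \<otimes> x \<and> len g = 2 \<and> le g c"
  then obtain x where x: "x \<in> A" "g = a \<otimes> x" "len g = 2" "le g c" by blast
  have a: "a \<in> carrier G" "len a = 1" using assms by auto
  have ag: "le a g"
    using le_iff_prod[of a x] x a by auto
  have "z = a \<or> z = g" if z: "le a z" "le z g" for z
  proof -
    have zc: "z \<in> carrier G" "g \<in> carrier G" using z by (auto simp: gen_le_def)
    have l: "1 + len (inv a \<otimes> z) = len z" "len z + len (inv z \<otimes> g) = 2"
      using z a x by (auto simp: gen_le_def)
    show ?thesis
    proof (cases "len z = 1")
      case True
      then have "inv a \<otimes> z = \<one>"
        using l len_eq_0 a zc by simp
      then show ?thesis using a zc inv_solve_left'[of \<one> a z] by simp
    next
      case False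
      then have "len (inv z \<otimes> g) = 0"
        using l by linarith
      then have "inv z \<otimes> g = \<one>"
        using len_eq_0 zc by simp
      then show ?thesis using zc inv_solve_left'[of \<one> z g] by simp
    qed
  qed
  moreover have "a \<noteq> g" using a x by auto
  ultimately show "covers_in (fact_poset G A c) le g a"
    using ag x le_trans[OF ag] le_one_left unfolding covers_in_def fact_poset_def
    by (auto simp: gen_le_def)
qed


section \<open>Compatible orders\<close>

context
  fixes c r
  assumes compatible: "compatible_order G A c r"
begin

lemma linear: "linear_order_on (gens_below G A c) r"
  using compatible by (simp add: compatible_order_def)

lemma unique_ascent:
  assumes "le h c" "len h = 2"
    and "x \<in> A" "y \<in> A" "x \<otimes> y = h" "(x, y) \<in> r"
    and "x' \<in> A" "y' \<in> A" "x' \<otimes> y' = h" "(x', y') \<in> r"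
  shows "x = x'" "y = y'"
proof -
  have "\<exists>!p. reduced_factorization G A h [fst p, snd p] \<and> p \<in> r"
    using compatible assms(1,2) by (simp add: compatible_order_def)
  then have "(x, y) = (x', y')"
    using reduced_pair_iff[OF assms(2)] assms by (metis fst_conv snd_conv)
  then show "x = x'" "y = y'" by auto
qed

text \<open>
  The map \<open>x \<mapsto> inv x \<otimes> g\<close> is the Hurwitz move \<open>(x, y) \<mapsto> (y, inv y \<otimes> x \<otimes> y)\<close> on
  factorizations of \<open>g\<close>, read off on first components.
\<close>
lemma card_le_period:
  assumes fin: "finite (gens_below G A g)" and g: "le g c" "len g = 2"
    and x: "x \<in> gens_below G A g" and d: "((\<lambda>x. inv x \<otimes> g) ^^ d) x = x" "d > 0"
  shows "card (gens_below G A g) \<le> d"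
proof -
  let ?S = "gens_below G A g"
  have gc: "g \<in> carrier G" using g by (simp add: gen_le_def)
  note S = gens_below_len_2[OF gc g(2)]
  \<comment> \<open>Extending by the identity outside the carrier makes the move injective on the
    whole type.\<close>
  define F where "F x = (if x \<in> carrier G then inv x \<otimes> g else x)" for x
  have "inj F"
  proof (rule injI)
    fix x y assume "F x = F y"
    then show "x = y"
      unfolding F_def using gc by (auto split: if_splits) (metis inv_inv)
  qed
  moreover have F_S: "F x = inv x \<otimes> g" if "x \<in> ?S" for x
    using that S by (auto simp: F_def)
  moreover have maps: "F x \<in> ?S" if "x \<in> ?S" for x
  proof -
    have x: "x \<in> A" "inv x \<otimes> g \<in> A" using that S by auto
    \<comment> \<open>Two moves amount to conjugation by \<open>g\<close>, which preserves
      \<open>A\<close>.\<close>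
    have "inv (inv x \<otimes> g) \<otimes> g = conj_by g x"
      using x gc by (simp add: inv_mult_group m_assoc)
    then show ?thesis
      using F_S[OF that] S x conj_mem gc by auto
  qed
  moreover have "linear_order_on ?S (r \<inter> ?S \<times> ?S)"
  proof -
    have "?S \<subseteq> gens_below G A c"
      using g le_trans by (auto simp: gens_below_def)
    then show ?thesis
      using linear unfolding order_on_defs
      by (auto 0 3 simp: refl_on_def antisym_def total_on_def intro!: transI dest: transD)
  qed
  moreover have "\<exists>!x. x \<in> ?S \<and> (x, F x) \<in> r \<inter> ?S \<times> ?S"
  proof -
    have red: "reduced_factorization G A g [fst p, snd p] \<longleftrightarrow> fst p \<in> ?S \<and> snd p = F (fst p)" for p
      using reduced_pair_iff[OF g(2)] S gc by (auto simp: F_def)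
    have "\<exists>!p. reduced_factorization G A g [fst p, snd p] \<and> p \<in> r"
      using compatible g by (simp add: compatible_order_def)
    then obtain p where p: "fst p \<in> ?S" "snd p = F (fst p)" "p \<in> r"
      and u: "\<And>q. fst q \<in> ?S \<Longrightarrow> snd q = F (fst q) \<Longrightarrow> q \<in> r \<Longrightarrow> q = p"
      unfolding red by blast
    show ?thesis
    proof (rule ex1I[of _ "fst p"])
      show "fst p \<in> ?S \<and> (fst p, F (fst p)) \<in> r \<inter> ?S \<times> ?S"
        using p maps by (metis IntI mem_Sigma_iff prod.collapse)
    next
      fix x assume "x \<in> ?S \<and> (x, F x) \<in> r \<inter> ?S \<times> ?S"
      then show "x = fst p" using u[of "(x, F x)"] by auto
    qed
  qed
  moreover have "(F ^^ d) x = x"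
  proof -
    have "(F ^^ i) x = ((\<lambda>x. inv x \<otimes> g) ^^ i) x \<and> (F ^^ i) x \<in> ?S" for i
      using x maps F_S by (induction i) auto
    then show ?thesis using d by simp
  qed
  ultimately show ?thesis
    using card_le_period_of_unique_ascent[of ?S "r \<inter> ?S \<times> ?S" F x d] fin x d(2) by blast
qed

text \<open>Produces the sequences for \<open>no_linked_unique_ascents\<close>: the conjugates, by
  powers of \<open>a \<otimes> b \<otimes> b\<close>, of five consecutive terms in the cycle of
  \<open>a \<otimes> b\<close>.\<close>

lemma no_square_extension:
  assumes fin: "finite (gens_below G A c)"
    and a: "a \<in> A" and b: "b \<in> A"
    and h: "le (a \<otimes> b \<otimes> b) c" "len (a \<otimes> b \<otimes> b) = 3"
    and card: "card (gens_below G A (a \<otimes> b)) \<ge> 4"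
  shows False
proof -
  define g where "g = a \<otimes> b"
  define h where "h = a \<otimes> b \<otimes> b"
  have ac: "a \<in> carrier G" "b \<in> carrier G" using a b by auto
  then have gc: "g \<in> carrier G" "h \<in> carrier G" by (auto simp: g_def h_def)
  have g2: "len g = 2" and gh: "le g h"
    using prefix_of_length_3[OF a b b] assms(5) by (auto simp: g_def h_def)
  have hle: "le h c" using assms(4) by (simp add: h_def)
  have g_le: "le g c" using le_trans[OF gh hle] .
  \<comment> \<open>\<open>s0, s1, a, b, s4\<close> are consecutive in the cycle of \<open>g\<close>, and conjugation by \<open>h\<close> maps
    \<open>(s0, s1)\<close> to \<open>(s4, b)\<close>.\<close>
  define s0 where "s0 = g \<otimes> a \<otimes> inv g"
  define s1 where "s1 = a \<otimes> b \<otimes> inv a"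
  define s4 where "s4 = conj_by b a"
  have sA: "s0 \<in> A" "s1 \<in> A" "s4 \<in> A"
    using conj_mem a b ac gc by (auto simp: s0_def s1_def s4_def)
  have prods: "s0 \<otimes> s1 = g" "s1 \<otimes> a = g" "a \<otimes> b = g" "b \<otimes> s4 = g"
    using ac by (auto simp: s0_def s1_def s4_def g_def m_assoc inv_mult_group)
  note S = gens_below_len_2[OF gc(1) g2]
  have F: "inv s0 \<otimes> g = s1" "inv s1 \<otimes> g = a" "inv a \<otimes> g = b" "inv b \<otimes> g = s4"
    using sA a b prods by (metis A_closed inv_cancel_left(1))+
  have sS: "s0 \<in> gens_below G A g" "s1 \<in> gens_below G A g" "a \<in> gens_below G A g"
    "b \<in> gens_below G A g"
    using F sA a b S by auto
  \<comment> \<open>An infinite set would have \<open>card\<close> 0.\<close>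
  have "finite (gens_below G A g)"
    using card by (metis card.infinite g_def not_numeral_le_zero)
  then have period: "\<not> ((\<lambda>x. inv x \<otimes> g) ^^ d) x = x"
    if "x \<in> gens_below G A g" "0 < d" "d < 4" for x d
    using card_le_period[OF _ g_le g2 that(1), of d] card that by (auto simp: g_def)
  \<comment> \<open>Excluding the periods 1, 2 and 3 separates four consecutive terms. The fifth,
    \<open>s4\<close>, returns to \<open>s0\<close> when the cycle has length 4.\<close>
  have ne: "s0 \<noteq> s1" "s0 \<noteq> a" "s0 \<noteq> b" "s1 \<noteq> a" "s1 \<noteq> b" "a \<noteq> b"
    using period[OF sS(1), of 1] period[OF sS(1), of 2] period[OF sS(1), of 3]
      period[OF sS(2), of 1] period[OF sS(2), of 2] period[OF sS(3), of 1]
    by (auto simp: F eval_nat_numeral)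
  have link: "conj_by h s0 = s4" "conj_by h s1 = b"
    using ac by (simp_all add: s0_def s1_def s4_def g_def h_def m_assoc inv_mult_group)
  define k where "k m = h [^] (m::nat)" for m
  define s where "s x m = conj_by (k m) x" for x m
  have kc: "k m \<in> carrier G" for m using gc by (simp add: k_def)
  \<comment> \<open>Since \<open>h\<close> is fixed, all conjugates of \<open>g\<close> by its
    powers stay below \<open>h\<close>, hence below \<open>c\<close>, where the compatible order
    applies.\<close>
  have kh: "conj_by (k m) h = h" for m
  proof -
    have "h \<otimes> k m = k m \<otimes> h"
      using gc by (simp add: k_def flip: nat_pow_Suc2)
    then show ?thesis using kc gc by (simp add: m_assoc)
  qed
  have s_mem: "s x m \<in> A" if "x \<in> A" for x m
    using conj_mem that kc by (simp add: s_def)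
  have s_mult: "s x m \<otimes> s y m = s (x \<otimes> y) m" if "x \<in> carrier G" "y \<in> carrier G" for x y m
    using that kc[of m] by (simp add: s_def m_assoc)
  have s_inj: "s x m = s y m \<longleftrightarrow> x = y" if "x \<in> carrier G" "y \<in> carrier G" for x y m
    using that kc[of m] by (simp add: s_def m_assoc)
  have sg: "len (s g m) = 2" "le (s g m) c" for m
    using len_conj[OF gc(1) kc] g2 le_conj[OF gh kc[of m]] le_trans[OF _ hle]
    by (auto simp: s_def kh)
  have s_below: "s x m \<in> gens_below G A c" if "x \<in> A" "inv x \<otimes> g \<in> A" for x m
  proof -
    have "le x g" using that S by (auto simp: gens_below_def)
    then have "le (s x m) (s g m)" using le_conj kc by (simp add: s_def)
    then show ?thesis
      using le_trans sg that s_mem by (auto simp: gens_below_def)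
  qed
  have s_Suc: "s x (Suc m) = s (conj_by h x) m" if "x \<in> carrier G" for x m
  proof -
    have "k (Suc m) = h \<otimes> k m"
      using gc nat_pow_Suc2[of h m] by (simp add: k_def)
    then show ?thesis
      using that kc[of m] gc by (simp add: s_def m_assoc inv_mult_group)
  qed
  \<comment> \<open>Distinct factorizations of \<open>g\<close> conjugate to distinct factorizations
    of \<open>s g m\<close>, only one of which ascends.\<close>
  have excl: "(s x' m, s y' m) \<notin> r"
    if "(s x m, s y m) \<in> r" "x \<in> A" "y \<in> A" "x \<otimes> y = g"
      "x' \<in> A" "y' \<in> A" "x' \<otimes> y' = g" "x \<noteq> x'" for x y x' y' m
    using unique_ascent(1)[OF sg(2)[of m] sg(1)[of m], of "s x m" "s y m" "s x' m" "s y' m"]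
      that s_mem s_mult[of x y m] s_mult[of x' y' m] s_inj[of x x' m] by auto
  \<comment> \<open>The term after \<open>s4\<close> in the cycle is also a generator, which puts
    the conjugates of \<open>s4\<close> below \<open>c\<close>.\<close>
  have s4S: "inv s4 \<otimes> g \<in> A"
  proof -
    have "inv s4 \<otimes> g = conj_by s4 b"
      using prods(4) sA ac by (metis A_closed inv_closed m_assoc)
    then show ?thesis using conj_mem b sA by auto
  qed
  show False
  proof (rule no_linked_unique_ascents[OF linear fin, where ?s0.0 = "s s0" and ?s1.0 = "s s1"
        and ?s2.0 = "s a" and ?s3.0 = "s b" and ?s4.0 = "s s4"])
    fix m
    show "{s s0 m, s s1 m, s a m, s b m, s s4 m} \<subseteq> gens_below G A c"
      using s_below F sA a b s4S by auto
    show "s s0 (Suc m) = s s4 m" "s s1 (Suc m) = s b m"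
      using s_Suc link sA by auto
    show "(s s1 m, s a m) \<notin> r \<and> (s a m, s b m) \<notin> r \<and> (s b m, s s4 m) \<notin> r"
      if "(s s0 m, s s1 m) \<in> r"
      using excl[OF that] sA a b prods ne by metis
    show "(s s1 m, s a m) \<notin> r \<and> (s a m, s b m) \<notin> r" if "(s b m, s s4 m) \<in> r"
      using excl[OF that] sA a b prods ne by metis
    show "s s1 m \<noteq> s b m"
      using s_inj ne sA b by auto
  qed
qed

text \<open>Extend \<open>g\<close> to some \<open>g \<otimes> y\<close> of length 3 below
  \<open>c\<close>. Hurwitz moves give further factorizations starting with \<open>a\<close>, whose
  second letter can only be \<open>a\<close> or \<open>b\<close> because few elements cover
  \<open>a\<close>. This forces either \<open>y = b\<close>, the square case, or
  \<open>y = a\<close> with \<open>a\<close> and \<open>b\<close> commuting.\<close>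

lemma card_le_3_of_unique_cover:
  assumes fin: "finite (gens_below G A c)" and c: "c \<in> carrier G" "len c \<ge> 3"
    and a: "a \<in> A"
    and cover: "{x. covers_in (fact_poset G A c) le x a} - {a \<otimes> a} = {g}"
  shows "card (gens_below G A g) \<le> 3"
proof (rule ccontr)
  assume "\<not> card (gens_below G A g) \<le> 3"
  then have card: "card (gens_below G A g) \<ge> 4" by simp
  obtain b where b: "b \<in> A" "g = a \<otimes> b" "len g = 2" "le g c" and "g \<noteq> a \<otimes> a"
    using cover covers_of_gen[OF a c(1)] by (metis DiffE insertI1 mem_Collect_eq)
  then have ab: "b \<noteq> a" by auto
  have gc: "g \<in> carrier G" using b by (simp add: gen_le_def)
  have cases: "x = a \<or> x = b" if "x \<in> A" "len (a \<otimes> x) = 2" "le (a \<otimes> x) c" for x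
  proof -
    have "a \<otimes> x = a \<otimes> a \<or> a \<otimes> x = g"
      using cover covers_of_gen[OF a c(1)] that by blast
    then show ?thesis using a b that by auto
  qed
  \<comment> \<open>Since \<open>c\<close> has length at least 3, the remainder
    \<open>inv g \<otimes> c\<close> has a first letter, which serves as \<open>y\<close>.\<close>
  have len_c: "len c = 2 + len (inv g \<otimes> c)"
    using b by (simp add: gen_le_def)
  then obtain y v where y: "y \<in> A" "v \<in> carrier G" "inv g \<otimes> c = y \<otimes> v"
      "len (inv g \<otimes> c) = Suc (len v)"
    using exists_first_letter[of "inv g \<otimes> c"] c gc by auto
  have c_eq: "c = (g \<otimes> y) \<otimes> v"
    using y c gc inv_cancel_left(2)[of g c] by (simp add: m_assoc)
  have "len (g \<otimes> y) \<le> 3"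
    using len_mult_le[of g y] len_eq_1[of y] y b gc by auto
  moreover have "len c \<le> len (g \<otimes> y) + len v"
    using c_eq len_mult_le[of "g \<otimes> y" v] y gc by auto
  ultimately have h3: "len (g \<otimes> y) = 3"
    using len_c y by simp
  then have hc: "le (g \<otimes> y) c"
    using le_iff_prod[of "g \<otimes> y" v] c_eq len_c y gc by auto
  have start: "x = a \<or> x = b" if "x \<in> A" "z \<in> A" "a \<otimes> x \<otimes> z = g \<otimes> y" for x z
    using prefix_of_length_3[OF a that(1,2)] that h3 hc cases le_trans by metis
  \<comment> \<open>Moving \<open>y\<close> to the left past \<open>b\<close> makes it the second
    letter.\<close>
  have "a \<otimes> y \<otimes> conj_by y b = g \<otimes> y"
    using a b y by (simp add: m_assoc)
  then have "y = a \<or> y = b"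
    using start[OF y(1) conj_mem(2)[OF b(1)]] y(1) by blast
  then show False
  proof
    assume "y = b"
    then show False
      using no_square_extension[OF fin a b(1)] hc h3 card b by auto
  next
    assume "y = a"
    \<comment> \<open>In \<open>a \<otimes> b \<otimes> a\<close>, first rewrite
      \<open>b \<otimes> a\<close> as \<open>a \<otimes> ?x\<close>, then move \<open>?x\<close>
      left past the second \<open>a\<close>; now \<open>?x\<close> is the second letter.\<close>
    let ?x = "conj_by a b"
    have xA: "?x \<in> A" using conj_mem a b by auto
    have "a \<otimes> ?x \<otimes> conj_by ?x a = g \<otimes> y"
      using a b xA \<open>y = a\<close> by (simp add: m_assoc inv_mult_group)
    then have "?x = a \<or> ?x = b"
      using start[OF xA conj_mem(2)[OF a]] xA by blast
    moreover have "?x \<noteq> a"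
    proof
      assume "?x = a"
      then have "b \<otimes> a = a \<otimes> a" using a b by (simp add: m_assoc inv_solve_left')
      then show False using a b ab by simp
    qed
    ultimately have comm: "b \<otimes> a = a \<otimes> b"
      using a b by (simp add: m_assoc inv_solve_left')
    have "inv a \<otimes> g = b" "inv b \<otimes> g = a"
      using a b(1,2) inv_cancel_left(1)[of b a] comm by auto
    \<comment> \<open>Commuting factors give a cycle of length 2, too short for four
      generators.\<close>
    then have "((\<lambda>x. inv x \<otimes> g) ^^ 2) a = a"
      by (simp add: eval_nat_numeral)
    moreover have "a \<in> gens_below G A g"
      using gens_below_len_2[OF gc b(3)] a b by auto
    moreover have "finite (gens_below G A g)"
      using card by (metis card.infinite not_numeral_le_zero)
    ultimately show False
      using card_le_period[OF _ b(4,3), of a 2] card by auto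
  qed
qed

end

end

theorem theorem6p9:
  fixes G (structure) and A :: "'a set" and c a g\<^sub>a b :: 'a
  assumes "group G"
    and "conj_closed_monoid_generators G A"
    and "\<one> \<notin> A"
    and "c \<in> carrier G"
    and "finite (gens_below G A c)"
    and "gen_length G A c \<ge> 3"
    and "a \<in> gens_below G A c"
    and "{x. covers_in (fact_poset G A c) (gen_le G A) x a} - {a \<otimes> a} = {g\<^sub>a}"
    and "totally_chain_connected (fact_poset G A c) (gen_le G A)"
    and "b \<in> gens_below G A c - {a}"
    and "gen_le G A (a \<otimes> b \<otimes> b) c"
    and "card (gens_below G A g\<^sub>a) \<ge> 4"
  shows "\<not> (\<exists>r. compatible_order G A c r)"
proof
  assume "\<exists>r. compatible_order G A c r"
  then obtain r where r: "compatible_order G A c r" by blast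
  interpret group G by fact
  interpret conj_generated_group G A
    by unfold_locales fact+
  have "a \<in> A" using assms(7) by (simp add: gens_below_def)
  then have "card (gens_below G A g\<^sub>a) \<le> 3"
    using card_le_3_of_unique_cover[OF r] assms(4-6,8) by blast
  then show False using assms(12) by simp
qed

end
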